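(* Let $\mathfrak g=\mathfrak g_{3,2}$ be the three-dimensional real Lie algebra with basis $e_1,e_2,e_3$ and nonzero brackets $[e_1,e_3]=e_1$, $[e_2,e_3]=e_1+e_2$, and let $(\mathfrak g,\nabla)$ be a flat Lie algebra. Then $(\mathfrak g,\nabla)$ is isomorphic to exactly one of the following flat Lie algebras (only nonzero products $e_ie_j=\nabla_{e_i}e_j$ are listed): $\mathfrak h_{0,1}$: $e_2e_2=\varepsilon e_3,\ e_3e_1=-e_1,\ e_3e_2=-e_1-e_2,\ e_3e_3=-2e_3$; $\varepsilon=\pm1$. $\mathfrak h_{0,2}$: $e_3e_1=-e_1,\ e_3e_2=-e_1-e_2,\ e_3e_3=\lambda e_3$; $\lambda\in\mathbb R$. $\mathfrak h_{0,3}$: $e_3e_1=-e_1,\ e_3e_2=-e_1-e_2,\ e_3e_3=e_2-e_3$. $\mathfrak h_{0,4}$: $e_2e_3=\lambda e_1,\ e_3e_1=-e_1,\ e_3e_2=(\lambda-1)e_1-e_2$; $\lambda\in\mathbb R\setminus\{0\}$. $\mathfrak h_{0,5}$: $e_1e_3=\lambda e_1,\ e_2e_3=\lambda e_2,\ e_3e_1=(\lambda-1)e_1,\ e_3e_2=-e_1+(\lambda-1)e_2,\ e_3e_3=\lambda e_3$; $\lambda\in\mathbb R\setminus\{0\}$. $\mathfrak h_{0,6}$: $e_1e_3=e_1,\ e_2e_3=e_2,\ e_3e_2=-e_1,\ e_3e_3=e_2+e_3$. $\mathfrak h_{2,1}$: $e_2e_2=e_1,\ e_2e_3=e_2,\ e_3e_1=-e_1,\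 e_3e_2=-e_1,\ e_3e_3=-e_2+e_3$. $\mathfrak h_{2,2}$: $e_1e_3=-e_1,\ e_2e_2=e_1,\ e_3e_1=-2e_1,\ e_3e_2=-e_1-e_2,\ e_3e_3=-e_2-e_3$.
   Context: A connection on a real Lie algebra $\mathfrak g$ is a bilinear map $\nabla:\mathfrak g\times\mathfrak g\to\mathfrak g$, $(X,Y)\mapsto\nabla_XY$. It is torsion-free if $\nabla_XY-\nabla_YX=[X,Y]$ for all $X,Y$, and flat if $\nabla_X\nabla_YZ-\nabla_Y\nabla_XZ-\nabla_{[X,Y]}Z=0$ for all $X,Y,Z$. A flat Lie algebra is a pair $(\mathfrak g,\nabla)$ with $\nabla$ a flat, torsion-free connection on $\mathfrak g$. Two flat torsion-free connections $\nabla^1,\nabla^2$ on $\mathfrak g$ are isomorphic if there is a Lie algebra automorphism $\Psi$ of $\mathfrak g$ with $\nabla^2_X=\Psi\circ\nabla^1_{\Psi^{-1}(X)}\circ\Psi^{-1}$ for all $X\in\mathfrak g$. Each admissible choice of the parameters gives a flat Lie algebra of the list. *)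

theory Defs
  imports "HOL-Analysis.Analysis"
begin

definition lie_algebra :: "('a::real_vector \<Rightarrow> 'a \<Rightarrow> 'a) \<Rightarrow> bool" where
  "lie_algebra br \<longleftrightarrow> bilinear br \<and> (\<forall>X. br X X = 0) \<and>
     (\<forall>X Y Z. br X (br Y Z) + br Y (br Z X) + br Z (br X Y) = 0)"

definition connection :: "('a::real_vector \<Rightarrow> 'a \<Rightarrow> 'a) \<Rightarrow> bool" where
  "connection nabla \<longleftrightarrow> bilinear nabla"

definition torsion_free ::
    "('a::real_vector \<Rightarrow> 'a \<Rightarrow> 'a) \<Rightarrow> ('a \<Rightarrow> 'a \<Rightarrow> 'a) \<Rightarrow> bool" where
  "torsion_free br nabla \<longleftrightarrow> (\<forall>X Y. nabla X Y - nabla Y X = br X Y)"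

definition flat ::
    "('a::real_vector \<Rightarrow> 'a \<Rightarrow> 'a) \<Rightarrow> ('a \<Rightarrow> 'a \<Rightarrow> 'a) \<Rightarrow> bool" where
  "flat br nabla \<longleftrightarrow>
     (\<forall>X Y Z. nabla X (nabla Y Z) - nabla Y (nabla X Z) - nabla (br X Y) Z = 0)"

definition flat_lie_algebra ::
    "('a::real_vector \<Rightarrow> 'a \<Rightarrow> 'a) \<Rightarrow> ('a \<Rightarrow> 'a \<Rightarrow> 'a) \<Rightarrow> bool" where
  "flat_lie_algebra br nabla \<longleftrightarrow>
     lie_algebra br \<and> connection nabla \<and> torsion_free br nabla \<and> flat br nabla"

definition lie_automorphism ::
    "('a::real_vector \<Rightarrow> 'a \<Rightarrow> 'a) \<Rightarrow> ('a \<Rightarrow> 'a) \<Rightarrow> bool" where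
  "lie_automorphism br \<Psi> \<longleftrightarrow>
     linear \<Psi> \<and> bij \<Psi> \<and> (\<forall>X Y. \<Psi> (br X Y) = br (\<Psi> X) (\<Psi> Y))"

definition isomorphic_connections ::
    "('a::real_vector \<Rightarrow> 'a \<Rightarrow> 'a) \<Rightarrow> ('a \<Rightarrow> 'a \<Rightarrow> 'a) \<Rightarrow> ('a \<Rightarrow> 'a \<Rightarrow> 'a) \<Rightarrow> bool" where
  "isomorphic_connections br nabla1 nabla2 \<longleftrightarrow>
     (\<exists>\<Psi>. lie_automorphism br \<Psi> \<and> (\<forall>X. nabla2 X = \<Psi> \<circ> nabla1 (inv \<Psi> X) \<circ> inv \<Psi>))"

abbreviation e1 :: "real ^ 3" where "e1 \<equiv> axis 1 1"
abbreviation e2 :: "real ^ 3" where "e2 \<equiv> axis 2 1"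
abbreviation e3 :: "real ^ 3" where "e3 \<equiv> axis 3 1"

text \<open>The bilinear map on \<open>real ^ 3\<close> whose value on the \<open>i\<close>-th and \<open>j\<close>-th standard
  basis vectors is \<open>T (i, j)\<close>.  Multiplication tables are written as updates of
  \<open>\<lambda>_. 0\<close>, so that only the nonzero products are listed.\<close>

definition bilinear_extension :: "(3 \<times> 3 \<Rightarrow> real ^ 3) \<Rightarrow> real ^ 3 \<Rightarrow> real ^ 3 \<Rightarrow> real ^ 3" where
  "bilinear_extension T X Y = (\<Sum>i\<in>UNIV. \<Sum>j\<in>UNIV. (X $ i * Y $ j) *\<^sub>R T (i, j))"

definition g32 :: "real ^ 3 \<Rightarrow> real ^ 3 \<Rightarrow> real ^ 3" where
  "g32 = bilinear_extension ((\<lambda>_. 0)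
     ((1, 3) := e1, (3, 1) := - e1, (2, 3) := e1 + e2, (3, 2) := - (e1 + e2)))"

text \<open>A family together with its parameter, if it has one.\<close>

datatype list_member =
  H01 real | H02 real | H03 | H04 real | H05 real | H06 | H21 | H22

fun admissible :: "list_member \<Rightarrow> bool" where
  "admissible (H01 \<epsilon>) \<longleftrightarrow> \<epsilon> = 1 \<or> \<epsilon> = -1"
| "admissible (H04 t) \<longleftrightarrow> t \<noteq> 0"
| "admissible (H05 t) \<longleftrightarrow> t \<noteq> 0"
| "admissible _ \<longleftrightarrow> True"

primrec list_table :: "list_member \<Rightarrow> 3 \<times> 3 \<Rightarrow> real ^ 3" where
  "list_table (H01 \<epsilon>) = (\<lambda>_. 0)
     ((2, 2) := \<epsilon> *\<^sub>R e3, (3, 1) := - e1, (3, 2) := - e1 - e2, (3, 3) := - 2 *\<^sub>R e3)"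
| "list_table (H02 t) = (\<lambda>_. 0)
     ((3, 1) := - e1, (3, 2) := - e1 - e2, (3, 3) := t *\<^sub>R e3)"
| "list_table H03 = (\<lambda>_. 0)
     ((3, 1) := - e1, (3, 2) := - e1 - e2, (3, 3) := e2 - e3)"
| "list_table (H04 t) = (\<lambda>_. 0)
     ((2, 3) := t *\<^sub>R e1, (3, 1) := - e1, (3, 2) := (t - 1) *\<^sub>R e1 - e2)"
| "list_table (H05 t) = (\<lambda>_. 0)
     ((1, 3) := t *\<^sub>R e1, (2, 3) := t *\<^sub>R e2, (3, 1) := (t - 1) *\<^sub>R e1,
      (3, 2) := - e1 + (t - 1) *\<^sub>R e2, (3, 3) := t *\<^sub>R e3)"
| "list_table H06 = (\<lambda>_. 0)
     ((1, 3) := e1, (2, 3) := e2, (3, 2) := - e1, (3, 3) := e2 + e3)"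
| "list_table H21 = (\<lambda>_. 0)
     ((2, 2) := e1, (2, 3) := e2, (3, 1) := - e1, (3, 2) := - e1, (3, 3) := - e2 + e3)"
| "list_table H22 = (\<lambda>_. 0)
     ((1, 3) := - e1, (2, 2) := e1, (3, 1) := - 2 *\<^sub>R e1, (3, 2) := - e1 - e2,
      (3, 3) := - e2 - e3)"

definition list_connection :: "list_member \<Rightarrow> real ^ 3 \<Rightarrow> real ^ 3 \<Rightarrow> real ^ 3" where
  "list_connection h = bilinear_extension (list_table h)"

lemma bilinear_bilinear_extension: "bilinear (bilinear_extension T)"
  unfolding bilinear_def
  by (auto intro!: linearI simp: bilinear_extension_def algebra_simps sum.distrib
      scaleR_sum_right)

lemma bilinear_extension_axis:
  "bilinear_extension T (axis i 1) (axis j 1) = T (i, j)"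
proof -
  have "(axis i 1 $ k * axis j 1 $ l) *\<^sub>R T (k, l) =
      (if l = j then if k = i then T (i, j) else 0 else 0)" for k l
    by (simp add: axis_def)
  then show ?thesis
    by (simp add: bilinear_extension_def)
qed

lemma lie_algebra_g32: "lie_algebra g32"
  unfolding lie_algebra_def
  by (simp add: g32_def bilinear_bilinear_extension)
     (simp add: bilinear_extension_def sum_3 vec_eq_iff forall_3 axis_def algebra_simps)

lemma flat_lie_algebra_list_connection:
  assumes "admissible h"
  shows "flat_lie_algebra g32 (list_connection h)"
  unfolding flat_lie_algebra_def connection_def
proof (intro conjI)
  show "lie_algebra g32"
    by (rule lie_algebra_g32)
  show "bilinear (list_connection h)"
    by (simp add: list_connection_def bilinear_bilinear_extension)
  show "torsion_free g32 (list_connection h)"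
    by (cases h) (simp_all add: torsion_free_def g32_def list_connection_def
        bilinear_extension_def sum_3 vec_eq_iff forall_3 axis_def algebra_simps)
  show "flat g32 (list_connection h)"
    by (cases h) (simp_all add: flat_def g32_def list_connection_def
        bilinear_extension_def sum_3 vec_eq_iff forall_3 axis_def algebra_simps)
qed

end

theory Submission
  imports Defs
begin

text \<open>
  Write \<open>L\<^sub>i = \<nabla>\<^bsub>e\<^sub>i\<^esub>\<close>.  Flatness says \<open>[L\<^sub>1, L\<^sub>2] = 0\<close>, \<open>[L\<^sub>1, L\<^sub>3] = L\<^sub>1\<close> and
  \<open>[L\<^sub>2, L\<^sub>3] = L\<^sub>1 + L\<^sub>2\<close>, so the traces of all powers of \<open>L\<^sub>1\<close> and \<open>L\<^sub>2\<close> vanish; hence \<open>L\<^sub>1\<close> and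
  \<open>L\<^sub>2\<close> are commuting nilpotent maps and annihilate a common nonzero vector \<open>v\<close>.  An automorphism moves
  \<open>v\<close> to a multiple of \<open>e\<^sub>3\<close>, \<open>e\<^sub>2\<close> or \<open>e\<^sub>1\<close>, and in each of the three cases the structure equations
  can be solved and normalised by the remaining automorphisms, which are exactly
  \<open>e\<^sub>1 \<mapsto> a e\<^sub>1\<close>, \<open>e\<^sub>2 \<mapsto> b e\<^sub>1 + a e\<^sub>2\<close>, \<open>e\<^sub>3 \<mapsto> c e\<^sub>1 + d e\<^sub>2 + e\<^sub>3\<close> with \<open>a \<noteq> 0\<close>.
  Comparing a few structure constants under these maps separates the members of the list.
\<close>

section \<open>Isomorphism as an equivalence relation, and transport of structure\<close>

lemma isomorphic_connections_sym:
  assumes "isomorphic_connections br m n"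
  shows "isomorphic_connections br n m"
proof -
  obtain \<Psi> where \<Psi>: "lie_automorphism br \<Psi>"
    and n: "\<And>X. n X = \<Psi> \<circ> m (inv \<Psi> X) \<circ> inv \<Psi>"
    using assms by (auto simp: isomorphic_connections_def)
  have lin: "linear \<Psi>" and bij: "bij \<Psi>" and hom: "\<And>X Y. \<Psi> (br X Y) = br (\<Psi> X) (\<Psi> Y)"
    using \<Psi> by (auto simp: lie_automorphism_def)
  have inv: "\<Psi> (inv \<Psi> X) = X" "inv \<Psi> (\<Psi> X) = X" for X
    using bij by (simp_all add: surj_f_inv_f bij_is_surj bij_is_inj)
  have "inv \<Psi> (br X Y) = br (inv \<Psi> X) (inv \<Psi> Y)" for X Y
    by (metis inv hom)
  moreover have "linear (inv \<Psi>)"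
    by (rule linearI) (metis inv linear_add[OF lin], metis inv linear_scale[OF lin])
  ultimately have "lie_automorphism br (inv \<Psi>)"
    using bij by (simp add: lie_automorphism_def bij_imp_bij_inv)
  moreover have "m X = inv \<Psi> \<circ> n (inv (inv \<Psi>) X) \<circ> inv (inv \<Psi>)" for X
    using bij by (simp add: n inv_inv_eq fun_eq_iff inv)
  ultimately show ?thesis
    unfolding isomorphic_connections_def by blast
qed

lemma isomorphic_connections_trans:
  assumes "isomorphic_connections br l m" "isomorphic_connections br m n"
  shows "isomorphic_connections br l n"
proof -
  obtain \<Psi> \<Phi> where \<Psi>: "lie_automorphism br \<Psi>" "\<And>X. m X = \<Psi> \<circ> l (inv \<Psi> X) \<circ> inv \<Psi>"
    and \<Phi>: "lie_automorphism br \<Phi>" "\<And>X. n X = \<Phi> \<circ> m (inv \<Phi> X) \<circ> inv \<Phi>"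
    using assms by (auto simp: isomorphic_connections_def)
  have "lie_automorphism br (\<Phi> \<circ> \<Psi>)"
    using \<Psi>(1) \<Phi>(1) by (auto simp: lie_automorphism_def linear_compose bij_comp)
  moreover have "inv (\<Phi> \<circ> \<Psi>) = inv \<Psi> \<circ> inv \<Phi>"
    using \<Psi>(1) \<Phi>(1) by (simp add: lie_automorphism_def o_inv_distrib)
  ultimately show ?thesis
    unfolding isomorphic_connections_def
    by (intro exI[of _ "\<Phi> \<circ> \<Psi>"]) (simp add: \<Psi>(2) \<Phi>(2) o_assoc)
qed

text \<open>Since \<open>\<Phi>\<close> is injective, each identity for \<open>m\<close> may be
  checked after applying \<open>\<Phi>\<close>, where it becomes the identity for
  \<open>n\<close>.\<close>

lemma flat_lie_algebra_pullback:
  assumes n: "flat_lie_algebra br n" and \<Phi>: "lie_automorphism br \<Phi>"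
    and m: "bilinear m" "\<And>X Y. \<Phi> (m X Y) = n (\<Phi> X) (\<Phi> Y)"
  shows "flat_lie_algebra br m" "isomorphic_connections br n m"
proof -
  have lin: "linear \<Phi>" and bij: "bij \<Phi>" and hom: "\<And>X Y. \<Phi> (br X Y) = br (\<Phi> X) (\<Phi> Y)"
    using \<Phi> by (auto simp: lie_automorphism_def)
  have inj: "\<Phi> X = \<Phi> Y \<longleftrightarrow> X = Y" for X Y
    using bij by (simp add: bij_is_inj inj_eq)
  have "\<Phi> (m X Y - m Y X) = \<Phi> (br X Y)" for X Y
    using n
    by (simp add: linear_diff[OF lin] m hom flat_lie_algebra_def torsion_free_def)
  moreover have "\<Phi> (m X (m Y Z) - m Y (m X Z) - m (br X Y) Z) = \<Phi> 0" for X Y Z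
    using n
    by (simp add: linear_diff[OF lin] linear_0[OF lin] m hom flat_lie_algebra_def flat_def)
  ultimately show "flat_lie_algebra br m"
    using n m(1) by (simp add: flat_lie_algebra_def connection_def torsion_free_def flat_def inj)
  have "n X = \<Phi> \<circ> m (inv \<Phi> X) \<circ> inv \<Phi>" for X
    using bij by (simp add: fun_eq_iff m surj_f_inv_f bij_is_surj)
  with \<Phi> have "isomorphic_connections br m n"
    unfolding isomorphic_connections_def by blast
  then show "isomorphic_connections br n m"
    by (rule isomorphic_connections_sym)
qed

section \<open>Coordinates and the automorphism group of \<open>g32\<close>\<close>

lemma vec3_expand: "x = x $ 1 *\<^sub>R e1 + x $ 2 *\<^sub>R e2 + x $ 3 *\<^sub>R e3"
  by (simp add: vec_eq_iff forall_3 axis_def)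

lemma bilinear_expand:
  assumes "bilinear n"
  shows "n X Y = bilinear_extension (\<lambda>(i, j). n (axis i 1) (axis j 1)) X Y"
  by (subst (1) vec3_expand[of X], subst (1) vec3_expand[of Y])
    (simp add: bilinear_extension_def sum_3 bilinear_ladd[OF assms] bilinear_radd[OF assms]
      bilinear_lmul[OF assms] bilinear_rmul[OF assms] algebra_simps)

lemma g32_nth:
  "g32 X Y $ 1 = X $ 1 * Y $ 3 - X $ 3 * Y $ 1 + X $ 2 * Y $ 3 - X $ 3 * Y $ 2"
  "g32 X Y $ 2 = X $ 2 * Y $ 3 - X $ 3 * Y $ 2"
  "g32 X Y $ 3 = 0"
  by (simp_all add: g32_def bilinear_extension_def sum_3 axis_def algebra_simps)

lemma g32_axis: "g32 e1 e2 = 0" "g32 e1 e3 = e1" "g32 e2 e3 = e1 + e2"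
  by (simp_all add: vec_eq_iff forall_3 g32_nth axis_def)

definition aut :: "real \<Rightarrow> real \<Rightarrow> real \<Rightarrow> real \<Rightarrow> real ^ 3 \<Rightarrow> real ^ 3" where
  "aut a b c d x = vector [a * x $ 1 + b * x $ 2 + c * x $ 3, a * x $ 2 + d * x $ 3, x $ 3]"

lemma aut_nth [simp]:
  "aut a b c d x $ 1 = a * x $ 1 + b * x $ 2 + c * x $ 3"
  "aut a b c d x $ 2 = a * x $ 2 + d * x $ 3"
  "aut a b c d x $ 3 = x $ 3"
  by (simp_all add: aut_def)

lemma linear_aut: "linear (aut a b c d)"
  by (rule linearI) (simp_all add: vec_eq_iff forall_3 algebra_simps)

lemma aut_inverse:
  assumes "a \<noteq> 0"
  obtains a' b' c' d' where "\<And>x. aut a b c d (aut a' b' c' d' x) = x"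
    "\<And>x. aut a' b' c' d' (aut a b c d x) = x"
proof
  \<comment> \<open>Back substitution in the triangular system
    \<open>aut a b c d \<circ> aut a' b' c' d' = id\<close>.\<close>
  define a' b' c' d' where "a' = 1 / a" and "b' = - b / a\<^sup>2" and "c' = (b * d / a - c) / a"
    and "d' = - d / a"
  show "aut a b c d (aut a' b' c' d' x) = x" "aut a' b' c' d' (aut a b c d x) = x" for x
    using assms
    by (simp_all add: vec_eq_iff forall_3 a'_def b'_def c'_def d'_def field_simps power2_eq_square)
qed

lemma lie_automorphism_aut:
  assumes "a \<noteq> 0"
  shows "lie_automorphism g32 (aut a b c d)"
proof -
  obtain a' b' c' d' where *: "\<And>x. aut a b c d (aut a' b' c' d' x) = x"
    "\<And>x. aut a' b' c' d' (aut a b c d x) = x"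
    using aut_inverse[OF assms] by metis
  have "bij (aut a b c d)"
    by (rule o_bij[of "aut a' b' c' d'"]) (simp_all add: fun_eq_iff *)
  then show ?thesis
    by (simp add: lie_automorphism_def linear_aut vec_eq_iff forall_3 g32_nth algebra_simps)
qed

text \<open>The derived algebra, spanned by \<open>e1\<close> and \<open>e2\<close>, is preserved.
  On it \<open>\<lambda>X. g32 X e3\<close> is a single Jordan block with eigenvalue 1; comparing it
  with its image forces \<open>\<Psi> e3 $ 3 = 1\<close>, fixes the line of \<open>e1\<close> and
  makes the two diagonal entries equal.\<close>

lemma lie_automorphism_g32E:
  assumes "lie_automorphism g32 \<Psi>"
  obtains a b c d where "a \<noteq> 0" "\<Psi> = aut a b c d"
proof -
  have lin: "linear \<Psi>" and bij: "bij \<Psi>" and hom: "\<And>X Y. \<Psi> (g32 X Y) = g32 (\<Psi> X) (\<Psi> Y)"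
    using assms by (auto simp: lie_automorphism_def)
  have E: "\<Psi> e1 = g32 (\<Psi> e1) (\<Psi> e3)" "\<Psi> e1 + \<Psi> e2 = g32 (\<Psi> e2) (\<Psi> e3)"
    by (metis hom g32_axis(2), metis hom g32_axis(3) linear_add[OF lin])
  have "\<Psi> e1 \<noteq> \<Psi> 0"
    using bij by (metis axis_eq_0_iff bij_is_inj injD zero_neq_one)
  then have "\<Psi> e1 \<noteq> 0"
    by (simp add: linear_0[OF lin])
  moreover have 3: "\<Psi> e1 $ 3 = 0" "\<Psi> e2 $ 3 = 0"
    using arg_cong[OF E(1), of "\<lambda>v. v $ 3"] arg_cong[OF E(2), of "\<lambda>v. v $ 3"]
    by (simp_all add: g32_nth)
  moreover have 12: "\<Psi> e1 $ 2 = \<Psi> e1 $ 2 * \<Psi> e3 $ 3"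
    "\<Psi> e1 $ 1 = (\<Psi> e1 $ 1 + \<Psi> e1 $ 2) * \<Psi> e3 $ 3"
    using arg_cong[OF E(1), of "\<lambda>v. v $ 2"] arg_cong[OF E(1), of "\<lambda>v. v $ 1"]
    unfolding g32_nth 3 by (simp_all add: algebra_simps)
  ultimately have *: "\<Psi> e1 $ 2 = 0" "\<Psi> e3 $ 3 = 1" "\<Psi> e1 $ 1 \<noteq> 0"
    unfolding vec_eq_iff forall_3 by auto
  moreover have "\<Psi> e2 $ 2 = \<Psi> e1 $ 1"
    using arg_cong[OF E(2), of "\<lambda>v. v $ 1"]
    unfolding vector_add_component g32_nth 3 * by simp
  note * = * 3 this
  have "\<Psi> x = aut (\<Psi> e1 $ 1) (\<Psi> e2 $ 1) (\<Psi> e3 $ 1) (\<Psi> e3 $ 2) x" for x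
    by (subst vec3_expand[of x])
      (simp add: linear_add[OF lin] linear_scale[OF lin] vec_eq_iff forall_3 * algebra_simps)
  with that *(3) show ?thesis
    by blast
qed

lemma aut_axis:
  "aut a b c d e1 = a *\<^sub>R e1" "aut a b c d e2 = b *\<^sub>R e1 + a *\<^sub>R e2"
  "aut a b c d e3 = c *\<^sub>R e1 + d *\<^sub>R e2 + e3"
  by (simp_all add: vec_eq_iff forall_3 axis_def)

lemma basis_nth [simp]:
  "e1 $ 1 = 1" "e1 $ 2 = 0" "e1 $ 3 = 0"
  "e2 $ 1 = 0" "e2 $ 2 = 1" "e2 $ 3 = 0"
  "e3 $ 1 = 0" "e3 $ 2 = 0" "e3 $ 3 = 1"
  by (simp_all add: axis_def)

lemma aut_eq_0_iff:
  assumes "a \<noteq> 0"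
  shows "aut a b c d x = 0 \<longleftrightarrow> x = 0"
  using assms by (auto simp: vec_eq_iff forall_3)

section \<open>Pairwise non-isomorphism of the members of the list\<close>

lemma list_connection_nth:
  "list_connection h X Y $ k = (\<Sum>i\<in>UNIV. \<Sum>j\<in>UNIV. X $ i * Y $ j * list_table h (i, j) $ k)"
  by (simp add: list_connection_def bilinear_extension_def)

text \<open>Seven numbers stay free in a table: coordinate 1 at \<open>(1, 3)\<close>, 1 and 3 at
  \<open>(2, 2)\<close>, 1 and 2 at \<open>(2, 3)\<close>, 2 and 3 at \<open>(3, 3)\<close>.\<close>

lemma list_table_shape:
  "list_table h (1, 1) $ k = 0" "list_table h (1, 2) $ k = 0" "list_table h (2, 1) $ k = 0"
  "list_table h (1, 3) $ 2 = 0" "list_table h (1, 3) $ 3 = 0"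
  "list_table h (2, 2) $ 2 = 0" "list_table h (2, 3) $ 3 = 0" "list_table h (3, 3) $ 1 = 0"
  "list_table h (3, 1) $ 1 = list_table h (1, 3) $ 1 - 1"
  "list_table h (3, 1) $ 2 = 0" "list_table h (3, 1) $ 3 = 0"
  "list_table h (3, 2) $ 1 = list_table h (2, 3) $ 1 - 1"
  "list_table h (3, 2) $ 2 = list_table h (2, 3) $ 2 - 1" "list_table h (3, 2) $ 3 = 0"
  by (cases h; simp add: axis_def)+

text \<open>Isomorphic members share coordinate 1 at \<open>(1, 3)\<close>, coordinate 2 at
  \<open>(2, 3)\<close>, coordinate 3 at \<open>(3, 3)\<close> and the sign of coordinate 3 at
  \<open>(2, 2)\<close>. The few coincidences of these invariants are resolved by two further
  equations.\<close>

lemma list_connection_unique: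
  assumes "admissible h" "admissible h'"
    and "isomorphic_connections g32 (list_connection h) (list_connection h')"
  shows "h = h'"
proof -
  obtain \<Psi> where \<Psi>: "lie_automorphism g32 \<Psi>"
    "\<And>X. list_connection h' X = \<Psi> \<circ> list_connection h (inv \<Psi> X) \<circ> inv \<Psi>"
    using assms(3) unfolding isomorphic_connections_def by blast
  then have "inj \<Psi>"
    by (simp add: lie_automorphism_def bij_is_inj)
  then have eq: "list_connection h' (\<Psi> (axis i 1)) (\<Psi> (axis j 1)) = \<Psi> (list_table h (i, j))"
    for i j
    by (simp add: \<Psi>(2) list_connection_def[of h] bilinear_extension_axis)
  obtain a b c d where a: "a \<noteq> 0" and "\<Psi> = aut a b c d"
    using lie_automorphism_g32E[OF \<Psi>(1)] .
  note eq = eq[unfolded this, THEN arg_cong[of _ _ "\<lambda>v. v $ k" for k],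
      unfolded list_connection_nth aut_nth sum_3]
  have e13: "list_table h (1, 3) $ 1 = list_table h' (1, 3) $ 1"
    using a eq[of 1 3 1] by (simp add: list_table_shape axis_def)
  have e22: "a\<^sup>2 * list_table h' (2, 2) $ 3 = list_table h (2, 2) $ 3"
    using eq[of 2 2 3] by (simp add: list_table_shape axis_def power2_eq_square)
  have e23: "list_table h (2, 3) $ 2 = list_table h' (2, 3) $ 2"
    "d = 0 \<or> list_table h' (2, 2) $ 3 = 0"
    "a * d * list_table h' (2, 2) $ 1 + b * list_table h' (1, 3) $ 1 + a * list_table h' (2, 3) $ 1
     = a * list_table h (2, 3) $ 1 + b * list_table h (2, 3) $ 2"
    using a eq[of 2 3 2] eq[of 2 3 3] eq[of 2 3 1]
    by (simp_all add: list_table_shape axis_def)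
  have e33: "d\<^sup>2 * list_table h' (2, 2) $ 3 + list_table h' (3, 3) $ 3 = list_table h (3, 3) $ 3"
    "d * (2 * list_table h' (2, 3) $ 2 - 1) + list_table h' (3, 3) $ 2
      = a * list_table h (3, 3) $ 2 + d * list_table h (3, 3) $ 3"
    using eq[of 3 3 2] eq[of 3 3 3]
    by (simp_all add: list_table_shape axis_def algebra_simps power2_eq_square)
  \<comment> \<open>By \<open>e23(2)\<close> the term with \<open>d\<^sup>2\<close>
    vanishes.\<close>
  have u: "list_table h' (3, 3) $ 3 = list_table h (3, 3) $ 3"
    using e33(1) e23(2) by auto
  have r: "sgn (list_table h' (2, 2) $ 3) = sgn (list_table h (2, 2) $ 3)"
    using a e22 by (metis mult_1 sgn_1_pos sgn_mult zero_less_power2)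
  \<comment> \<open>The invariants leave the pairs \<open>H02 (-1)\<close> and \<open>H03\<close>,
    \<open>H02 0\<close> and \<open>H04\<close>, \<open>H05 1\<close> and \<open>H06\<close>, and
    two members of \<open>H04\<close>. There \<open>e23(3)\<close> or \<open>e33(2)\<close> decides,
    because \<open>a \<noteq> 0\<close>.\<close>
  show ?thesis
    using assms(1,2) e13 e23(1) u r
    by (cases h; cases h'; simp add: axis_def) (use a e23(3) e33(2) in \<open>auto simp: axis_def\<close>)
qed

section \<open>Traces and nilpotency\<close>

text \<open>tr(XPY) = tr(YXP) = tr(XYP) by cyclicity and commutation. If [A,P] = A, this gives
  tr(XA) = 0 for every X commuting with A.\<close>

lemma trace_matrix_mult_commutator:
  fixes X Y P :: "real ^ 'n ^ 'n"
  assumes "X ** Y = Y ** X"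
  shows "trace (X ** (Y ** P - P ** Y)) = 0"
proof -
  have "trace (X ** (P ** Y)) = trace (X ** (Y ** P))"
    by (metis assms matrix_mul_assoc trace_mul_sym)
  moreover have "X ** (Y ** P - P ** Y) = X ** (Y ** P) - X ** (P ** Y)"
    by (simp add: matrix_eq matrix_vector_mult_diff_rdistrib matrix_vector_mult_diff_distrib
        flip: matrix_vector_mul_assoc)
  ultimately show ?thesis
    by (simp add: trace_sub)
qed

text \<open>The identity in the proof is Cayley-Hamilton, with coefficients written in power traces
  by Newton's identities and multiplied by 6 to clear denominators.\<close>

lemma cube_eq_0_if_traces_eq_0:
  fixes M :: "real ^ 3 ^ 3"
  assumes "trace M = 0" "trace (M ** M) = 0" "trace (M ** M ** M) = 0"
  shows "M ** M ** M = 0"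
proof -
  have "6 * (M ** M ** M) $ i $ j = 6 * trace M * (M ** M) $ i $ j
      - 3 * ((trace M)\<^sup>2 - trace (M ** M)) * M $ i $ j
      + ((trace M) ^ 3 - 3 * trace M * trace (M ** M) + 2 * trace (M ** M ** M)) * mat 1 $ i $ j"
    for i j
    using exhaust_3[of i] exhaust_3[of j]
    by (auto simp: trace_def matrix_matrix_mult_def sum_3 mat_def power2_eq_square power3_eq_cube
        algebra_simps)
  then show ?thesis
    by (simp add: vec_eq_iff assms)
qed

section \<open>Structure equations and the common kernel\<close>

text \<open>Only the existence half; uniqueness rests on
  \<open>list_connection_unique\<close>.\<close>

definition classified :: "(real ^ 3 \<Rightarrow> real ^ 3 \<Rightarrow> real ^ 3) \<Rightarrow> bool" where
  "classified n \<longleftrightarrow> (\<exists>h. admissible h \<and> isomorphic_connections g32 n (list_connection h))"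

locale flat_g32 =
  fixes n :: "real ^ 3 \<Rightarrow> real ^ 3 \<Rightarrow> real ^ 3"
  assumes flat: "flat_lie_algebra g32 n"
begin

lemma bilinear: "bilinear n"
  using flat by (simp add: flat_lie_algebra_def connection_def)

lemmas n_add = bilinear_ladd[OF bilinear] bilinear_radd[OF bilinear]
lemmas n_scale = bilinear_lmul[OF bilinear] bilinear_rmul[OF bilinear]

lemma n_expand: "n x y = x $ 1 *\<^sub>R n e1 y + x $ 2 *\<^sub>R n e2 y + x $ 3 *\<^sub>R n e3 y"
  "n x y = y $ 1 *\<^sub>R n x e1 + y $ 2 *\<^sub>R n x e2 + y $ 3 *\<^sub>R n x e3"
  by (subst vec3_expand[of x], simp add: n_add n_scale,
      subst vec3_expand[of y], simp add: n_add n_scale)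

lemma torsion: "n e2 e1 = n e1 e2" "n e3 e1 = n e1 e3 - e1" "n e3 e2 = n e2 e3 - e1 - e2"
proof -
  have "n X Y - n Y X = g32 X Y" for X Y
    using flat by (simp add: flat_lie_algebra_def torsion_free_def)
  from this[of e1 e2] this[of e1 e3] this[of e2 e3]
  show "n e2 e1 = n e1 e2" "n e3 e1 = n e1 e3 - e1" "n e3 e2 = n e2 e3 - e1 - e2"
    by (simp_all add: g32_axis algebra_simps)
qed

lemma curvature:
  "n e1 (n e2 x) = n e2 (n e1 x)"
  "n e1 (n e3 x) - n e3 (n e1 x) = n e1 x"
  "n e2 (n e3 x) - n e3 (n e2 x) = n e1 x + n e2 x"
proof -
  have "n X (n Y Z) - n Y (n X Z) = n (g32 X Y) Z" for X Y Z
    using flat by (simp add: flat_lie_algebra_def flat_def)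
  from this[of e1 e2] this[of e1 e3] this[of e2 e3]
  show "n e1 (n e2 x) = n e2 (n e1 x)"
    "n e1 (n e3 x) - n e3 (n e1 x) = n e1 x"
    "n e2 (n e3 x) - n e3 (n e2 x) = n e1 x + n e2 x"
    by (simp_all add: g32_axis n_add bilinear_lzero[OF bilinear])
qed

text \<open>For \<open>A\<close> the commutator relation [A,P] = A kills the traces of A, A^2, A^3.
  For \<open>B\<close> it is [B,P] = A + B, so tr(XB) = -tr(XA) when X is a power of B; the right
  side vanishes since such X also commute with A.\<close>

lemma nilpotent:
  "trace (matrix (n e1)) = 0" "trace (matrix (n e1) ** matrix (n e1)) = 0"
  "n e1 (n e1 (n e1 x)) = 0"
  "trace (matrix (n e2)) = 0" "trace (matrix (n e2) ** matrix (n e2)) = 0"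
  "n e2 (n e2 (n e2 x)) = 0"
proof -
  define A B P where "A = matrix (n e1)" "B = matrix (n e2)" "P = matrix (n e3)"
  have lin: "linear (n z)" for z
    using bilinear by (simp add: bilinear_def)
  have A: "A *v x = n e1 x" and B: "B *v x = n e2 x" and P: "P *v x = n e3 x" for x
    by (simp_all add: A_B_P_def fun_cong[OF matrix_vector_mul(2)[OF lin]])
  have AB: "A ** B = B ** A" and AP: "A ** P - P ** A = A" and BP: "B ** P - P ** B = A + B"
    unfolding matrix_eq
    by (simp_all add: matrix_vector_mult_diff_rdistrib matrix_vector_mult_add_rdistrib
        A B P curvature flip: matrix_vector_mul_assoc)
  have trA: "trace (X ** A) = 0" if "X ** A = A ** X" for X
    using trace_matrix_mult_commutator[OF that, of P] by (simp add: AP)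
  have trB: "trace (X ** A) + trace (X ** B) = 0" if "X ** B = B ** X" for X
    using trace_matrix_mult_commutator[OF that, of P]
    by (simp add: BP matrix_add_ldistrib trace_add)
  have trA': "trace A = 0" "trace (A ** A) = 0" "trace (A ** A ** A) = 0"
    using trA[of "mat 1"] trA[of A] trA[of "A ** A"] by (simp_all add: matrix_mul_assoc)
  have trBA: "trace (B ** A) = 0" "trace (B ** B ** A) = 0"
    using trA[of B] trA[of "B ** B"] AB by (metis matrix_mul_assoc)+
  have trB': "trace B = 0" "trace (B ** B) = 0" "trace (B ** B ** B) = 0"
    using trB[of "mat 1"] trB[of B] trB[of "B ** B"] trA'(1) trBA
    by (simp_all add: matrix_mul_assoc)
  have "A ** A ** A = 0" "B ** B ** B = 0"
    using cube_eq_0_if_traces_eq_0 trA' trB' by blast+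
  then have "(A ** A ** A) *v x = 0" "(B ** B ** B) *v x = 0"
    by simp_all
  then show "n e1 (n e1 (n e1 x)) = 0" "n e2 (n e2 (n e2 x)) = 0"
    by (simp_all add: A B flip: matrix_vector_mul_assoc)
  show "trace (matrix (n e1)) = 0" "trace (matrix (n e1) ** matrix (n e1)) = 0"
    "trace (matrix (n e2)) = 0" "trace (matrix (n e2) ** matrix (n e2)) = 0"
    using trA' trB' by (simp_all add: A_B_P_def)
qed

text \<open>The kernel of \<open>n e1\<close> is nonzero and, as the two maps commute, stable under
  \<open>n e2\<close>. The last nonzero vector among \<open>u\<close>, \<open>n e2 u\<close>,
  \<open>n e2 (n e2 u)\<close> then lies in both kernels.\<close>

lemma kernelE:
  obtains v where "v \<noteq> 0" "n e1 v = 0" "n e2 v = 0"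
proof -
  have "\<exists>u. u \<noteq> 0 \<and> n e1 u = 0"
    using nilpotent(3)[of e1] by (metis axis_eq_0_iff zero_neq_one)
  then obtain u where u: "u \<noteq> 0" "n e1 u = 0"
    by blast
  have *: "n e1 (n e2 x) = 0" if "n e1 x = 0" for x
    by (simp add: curvature(1) that bilinear_rzero[OF bilinear])
  show ?thesis
    using that u * nilpotent(6)[of u] by metis
qed

lemma trace_e1:
  "n e1 e1 $ 1 + n e1 e2 $ 2 + n e1 e3 $ 3 = 0"
  "(n e1 e1 $ 1)\<^sup>2 + (n e1 e2 $ 2)\<^sup>2 + (n e1 e3 $ 3)\<^sup>2 + 2 * n e1 e1 $ 2 * n e1 e2 $ 1
    + 2 * n e1 e1 $ 3 * n e1 e3 $ 1 + 2 * n e1 e2 $ 3 * n e1 e3 $ 2 = 0"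
  and trace_e2:
  "n e1 e2 $ 1 + n e2 e2 $ 2 + n e2 e3 $ 3 = 0"
  "(n e1 e2 $ 1)\<^sup>2 + (n e2 e2 $ 2)\<^sup>2 + (n e2 e3 $ 3)\<^sup>2 + 2 * n e1 e2 $ 2 * n e2 e2 $ 1
    + 2 * n e1 e2 $ 3 * n e2 e3 $ 1 + 2 * n e2 e2 $ 3 * n e2 e3 $ 2 = 0"
  using nilpotent(1,2,4,5)
  by (simp_all add: trace_def matrix_matrix_mult_def matrix_def sum_3 torsion power2_eq_square
      algebra_simps)

section \<open>Change of basis and comparison with a table\<close>

text \<open>\<open>m\<close> has the structure constants of \<open>n\<close> in the basis formed by
  the images of \<open>e1\<close>, \<open>e2\<close>, \<open>e3\<close>. This allows a convenient
  basis to be assumed.\<close>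

lemma aut_pullbackE:
  assumes "a \<noteq> 0"
  obtains m where "flat_g32 m" "classified m \<Longrightarrow> classified n"
    "\<And>X Y. aut a b c d (m X Y) = n (aut a b c d X) (aut a b c d Y)"
proof -
  obtain a' b' c' d' where *: "\<And>x. aut a b c d (aut a' b' c' d' x) = x"
    using aut_inverse[OF assms] by metis
  define m where "m X Y = aut a' b' c' d' (n (aut a b c d X) (aut a b c d Y))" for X Y
  have "bilinear m"
    unfolding bilinear_def m_def
    by (intro conjI allI linearI)
      (simp_all add: linear_add[OF linear_aut] linear_scale[OF linear_aut] n_add n_scale)
  moreover have m: "aut a b c d (m X Y) = n (aut a b c d X) (aut a b c d Y)" for X Y
    by (simp add: m_def *)
  ultimately have "flat_lie_algebra g32 m" "isomorphic_connections g32 n m"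
    using flat_lie_algebra_pullback[OF flat lie_automorphism_aut[OF assms]] by blast+
  then show ?thesis
    using that m isomorphic_connections_trans unfolding flat_g32_def classified_def by blast
qed

lemma classified_by_aut:
  assumes "a \<noteq> 0" "admissible h"
    and "\<And>i j. n (aut a b c d (axis i 1)) (aut a b c d (axis j 1)) = aut a b c d (list_table h (i, j))"
  shows "classified n"
proof -
  define \<Phi> where "\<Phi> = aut a b c d"
  have lin: "linear \<Phi>"
    by (simp add: \<Phi>_def linear_aut)
  have bil: "bilinear (list_connection h)"
    by (simp add: list_connection_def bilinear_bilinear_extension)
  have "bilinear (\<lambda>X Y. \<Phi> (list_connection h X Y))"
    using linear_compose[OF _ lin] bil by (auto simp: bilinear_def o_def)
  moreover have "bilinear (\<lambda>X Y. n (\<Phi> X) (\<Phi> Y))"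
    unfolding bilinear_def
    by (intro conjI allI linearI)
      (simp_all add: linear_add[OF lin] linear_scale[OF lin] n_add n_scale)
  ultimately have "\<Phi> (list_connection h X Y) = n (\<Phi> X) (\<Phi> Y)" for X Y
    using assms(3)
    by (subst (1 2) bilinear_expand)
      (simp_all add: \<Phi>_def list_connection_def bilinear_extension_axis)
  then have "isomorphic_connections g32 n (list_connection h)"
    unfolding \<Phi>_def
    by (rule flat_lie_algebra_pullback(2)[OF flat lie_automorphism_aut[OF assms(1)] bil])
  with assms(2) show ?thesis
    by (auto simp: classified_def)
qed

text \<open>Inner products are expanded in the basis and torsion removes \<open>n e2 e1\<close>,
  \<open>n e3 e1\<close>, \<open>n e3 e2\<close>. At basis vectors the equations thus involve only
  the six products of \<open>ei\<close> and \<open>ej\<close> with i \<le> j.\<close>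

lemma curvature_expand:
  "n e2 x $ 1 *\<^sub>R n e1 e1 + n e2 x $ 2 *\<^sub>R n e1 e2 + n e2 x $ 3 *\<^sub>R n e1 e3 =
    n e1 x $ 1 *\<^sub>R n e1 e2 + n e1 x $ 2 *\<^sub>R n e2 e2 + n e1 x $ 3 *\<^sub>R n e2 e3"
  "n e3 x $ 1 *\<^sub>R n e1 e1 + n e3 x $ 2 *\<^sub>R n e1 e2 + n e3 x $ 3 *\<^sub>R n e1 e3 =
    n e1 x + n e1 x $ 1 *\<^sub>R (n e1 e3 - e1) + n e1 x $ 2 *\<^sub>R (n e2 e3 - e1 - e2) + n e1 x $ 3 *\<^sub>R n e3 e3"
  "n e3 x $ 1 *\<^sub>R n e1 e2 + n e3 x $ 2 *\<^sub>R n e2 e2 + n e3 x $ 3 *\<^sub>R n e2 e3 =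
    n e1 x + n e2 x + n e2 x $ 1 *\<^sub>R (n e1 e3 - e1) + n e2 x $ 2 *\<^sub>R (n e2 e3 - e1 - e2)
    + n e2 x $ 3 *\<^sub>R n e3 e3"
  using curvature[of x] n_expand(2)[of e1 "n e2 x"] n_expand(2)[of e2 "n e1 x"]
    n_expand(2)[of e1 "n e3 x"] n_expand(2)[of e3 "n e1 x"]
    n_expand(2)[of e2 "n e3 x"] n_expand(2)[of e3 "n e2 x"]
  unfolding torsion by (simp_all add: algebra_simps)

lemmas curvature_e1 = curvature_expand[of e1, unfolded torsion vec_eq_iff forall_3, simplified]
lemmas curvature_e2 = curvature_expand[of e2, unfolded torsion vec_eq_iff forall_3, simplified]
lemmas curvature_e3 = curvature_expand[of e3, unfolded torsion vec_eq_iff forall_3, simplified]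

text \<open>Torsion determines the products in reversed order, so four products remain to be
  compared. The left sides of the last four assumptions are these products of the images of the
  basis under \<open>aut a b c d\<close>.\<close>

lemma classified_if_table:
  assumes "a \<noteq> 0" "admissible h" and n0: "n e1 e1 = 0" "n e1 e2 = 0"
    and n13: "a *\<^sub>R n e1 e3 = aut a b c d (list_table h (1, 3))"
    and n22: "a\<^sup>2 *\<^sub>R n e2 e2 = aut a b c d (list_table h (2, 2))"
    and n23: "b *\<^sub>R n e1 e3 + (a * d) *\<^sub>R n e2 e2 + a *\<^sub>R n e2 e3 =
       aut a b c d (list_table h (2, 3))"
    and n33: "c *\<^sub>R (2 *\<^sub>R n e1 e3 - e1) + d\<^sup>2 *\<^sub>R n e2 e2
       + d *\<^sub>R (2 *\<^sub>R n e2 e3 - e1 - e2) + n e3 e3 = aut a b c d (list_table h (3, 3))"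
  shows "classified n"
proof (rule classified_by_aut[OF assms(1,2)])
  let ?\<Phi> = "aut a b c d"
  have 0: "list_table h (1, 1) = 0" "list_table h (1, 2) = 0" "list_table h (2, 1) = 0" "?\<Phi> 0 = 0"
    and 1: "list_table h (3, 1) = list_table h (1, 3) - e1"
     "list_table h (3, 2) = list_table h (2, 3) - (e1 + e2)"
    by (simp_all add: vec_eq_iff forall_3 list_table_shape)
  have 11: "n (?\<Phi> e1) (?\<Phi> e1) = ?\<Phi> (list_table h (1, 1))"
    "n (?\<Phi> e1) (?\<Phi> e2) = ?\<Phi> (list_table h (1, 2))"
    "n (?\<Phi> e2) (?\<Phi> e1) = ?\<Phi> (list_table h (2, 1))"
    unfolding 0 by (simp_all add: aut_axis n_add n_scale torsion n0)
  have 13: "n (?\<Phi> e1) (?\<Phi> e3) = ?\<Phi> (list_table h (1, 3))"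
    unfolding n13[symmetric] by (simp add: aut_axis n_add n_scale n0)
  have 22: "n (?\<Phi> e2) (?\<Phi> e2) = ?\<Phi> (list_table h (2, 2))"
    unfolding n22[symmetric] by (simp add: aut_axis n_add n_scale torsion n0 power2_eq_square)
  have 23: "n (?\<Phi> e2) (?\<Phi> e3) = ?\<Phi> (list_table h (2, 3))"
    unfolding n23[symmetric] by (simp add: aut_axis n_add n_scale torsion n0 algebra_simps)
  have 33: "n (?\<Phi> e3) (?\<Phi> e3) = ?\<Phi> (list_table h (3, 3))"
    unfolding n33[symmetric]
    by (simp add: aut_axis n_add n_scale torsion n0 algebra_simps power2_eq_square scaleR_2)
  have sym: "n (?\<Phi> Y) (?\<Phi> X) = n (?\<Phi> X) (?\<Phi> Y) - ?\<Phi> (g32 X Y)" for X Y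
  proof -
    have "n (?\<Phi> X) (?\<Phi> Y) - n (?\<Phi> Y) (?\<Phi> X) = ?\<Phi> (g32 X Y)"
      using flat lie_automorphism_aut[OF assms(1), of b c d]
      by (simp add: flat_lie_algebra_def torsion_free_def lie_automorphism_def)
    then show ?thesis
      by (simp add: algebra_simps)
  qed
  have 31: "n (?\<Phi> e3) (?\<Phi> e1) = ?\<Phi> (list_table h (3, 1))"
    "n (?\<Phi> e3) (?\<Phi> e2) = ?\<Phi> (list_table h (3, 2))"
    unfolding 1 linear_diff[OF linear_aut] sym[of e3 e1] sym[of e3 e2] 13 23 g32_axis by simp_all
  show "n (?\<Phi> (axis i 1)) (?\<Phi> (axis j 1)) = ?\<Phi> (list_table h (i, j))" for i j
    using exhaust_3[of i] exhaust_3[of j] 11 13 22 23 33 31 by metis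
qed

section \<open>Normal forms when products within the derived algebra vanish\<close>

lemma classified_if_all_zero:
  assumes "n e1 e1 = 0" "n e1 e2 = 0" "n e1 e3 = 0" "n e2 e2 = 0" "n e2 e3 = 0"
  shows "classified n"
proof -
  define u where "u = n e3 e3"
  consider "u $ 3 \<noteq> -1" | "u $ 3 = -1" "u $ 2 = 0" | "u $ 3 = -1" "u $ 2 \<noteq> 0"
    by blast
  then show ?thesis
  proof cases
    case 1
    \<comment> \<open>Replacing \<open>e3\<close> by \<open>c e1 + d e2 + e3\<close> turns
      \<open>n e3 e3\<close> into a multiple of the new \<open>e3\<close>. For
      \<open>u $ 3 = -1\<close> this can remove only the \<open>e1\<close>-component; a nonzero
      \<open>u $ 2\<close> persists and is scaled to 1 in \<open>H03\<close>.\<close>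
    define d where "d = u $ 2 / (u $ 3 + 1)"
    define c where "c = (u $ 1 - d) / (u $ 3 + 1)"
    have "u $ 2 = d * (u $ 3 + 1)" "u $ 1 = c * (u $ 3 + 1) + d"
      using 1 by (simp_all add: c_def d_def)
    then show ?thesis
      by (intro classified_if_table[of 1 "H02 (u $ 3)" 0 c d])
        (simp_all add: assms vec_eq_iff forall_3 algebra_simps flip: u_def)
  next
    case 2
    then show ?thesis
      by (intro classified_if_table[of 1 "H02 (-1)" 0 0 "u $ 1"])
        (simp_all add: assms vec_eq_iff forall_3 flip: u_def)
  next
    case 3
    then show ?thesis
      by (intro classified_if_table[of "u $ 2" H03 0 0 "u $ 1"])
        (simp_all add: assms vec_eq_iff forall_3 flip: u_def)
  qed
qed

lemma classified_if_derived_products_zero: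
  assumes "n e1 e1 = 0" "n e1 e2 = 0" "n e2 e2 = 0"
  shows "classified n"
proof -
  define s f u l where "s = n e1 e3" and "f = n e2 e3" and "u = n e3 e3" and "l = u $ 3"
  have 3: "s $ 3 = 0" "f $ 3 = 0"
    using trace_e1(1) trace_e2(1) by (simp_all add: assms s_def f_def)
  have eqs: "s $ 1 * (l - s $ 1) = s $ 2 * (f $ 1 - 1)" "s $ 2 * (l - s $ 1 - f $ 2) = 0"
    "f $ 1 * (l - s $ 1 - f $ 2) = s $ 1 - f $ 2" "f $ 2 * (l - f $ 2) = s $ 2 * (f $ 1 + 1)"
    using curvature_e3(2,3)
    by (simp_all add: assms 3 algebra_simps l_def flip: s_def f_def u_def)
  have s2: "s $ 2 = 0"
  proof (rule ccontr)
    assume *: "s $ 2 \<noteq> 0"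
    with eqs(2) have "l = s $ 1 + f $ 2"
      by simp
    \<comment> \<open>Both left sides become \<open>s $ 1 * f $ 2\<close>, so subtracting
      \<open>eqs(1)\<close> from \<open>eqs(4)\<close> gives \<open>2 * s $ 2 = 0\<close>.\<close>
    then show False
      using eqs(1,4) * by (simp add: algebra_simps)
  qed
  have "s $ 1 = 0 \<or> s $ 1 = l" "f $ 2 = 0 \<or> f $ 2 = l"
    using eqs(1,4) s2 by auto
  \<comment> \<open>If the two differed, one would be 0 and the other \<open>l\<close>; the left
    side of \<open>eqs(3)\<close> would vanish and make them equal.\<close>
  then have f2: "f $ 2 = s $ 1"
    using eqs(3) by auto
  then have *: "s $ 1 = 0 \<and> (f $ 1 = 0 \<or> l = 0) \<or> s $ 1 = l \<and> l \<noteq> 0 \<and> f $ 1 = 0"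
    using eqs(1,3) s2 by auto
  consider "s $ 1 = 0" "f $ 1 = 0" | "s $ 1 = 0" "f $ 1 \<noteq> 0" "l = 0"
    | "s $ 1 = l" "l \<noteq> 0" "f $ 1 = 0" "l \<noteq> 1"
    | "s $ 1 = l" "l \<noteq> 0" "f $ 1 = 0" "l = 1" "u $ 2 = 0"
    | "s $ 1 = l" "l \<noteq> 0" "f $ 1 = 0" "l = 1" "u $ 2 \<noteq> 0"
    using * by blast
  then show ?thesis
  proof cases
    case 1
    then have "s = 0" "f = 0"
      by (simp_all add: vec_eq_iff forall_3 3 s2 f2)
    then show ?thesis
      using classified_if_all_zero assms by (simp add: s_def f_def)
  next
    case 2
    then show ?thesis
      by (intro classified_if_table[of 1 "H04 (f $ 1)" 0 "u $ 1 + u $ 2 * (2 * f $ 1 - 1)" "u $ 2"])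
        (simp_all add: assms vec_eq_iff forall_3 3 s2 f2 l_def algebra_simps
          flip: s_def f_def u_def)
  next
    case 3
    \<comment> \<open>The change of \<open>e3\<close> again straightens \<open>n e3 e3\<close>; here
      the exceptional value is \<open>l = 1\<close>, where a nonzero \<open>u $ 2\<close> leads to
      \<open>H06\<close>.\<close>
    define d where "d = u $ 2 / (1 - l)"
    define c where "c = (u $ 1 - d) / (1 - l)"
    have "u $ 2 = d * (1 - l)" "u $ 1 = c * (1 - l) + d"
      using 3 by (simp_all add: c_def d_def)
    with 3 show ?thesis
      by (intro classified_if_table[of 1 "H05 l" 0 c d])
        (simp_all add: assms vec_eq_iff forall_3 \<open>s $ 3 = 0\<close> \<open>f $ 3 = 0\<close> s2 f2 algebra_simps
          flip: s_def f_def u_def l_def)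
  next
    case 4
    then show ?thesis
      by (intro classified_if_table[of 1 "H05 1" 0 0 "u $ 1"])
        (simp_all add: assms vec_eq_iff forall_3 3 s2 f2 algebra_simps
          flip: s_def f_def u_def l_def)
  next
    case 5
    then show ?thesis
      by (intro classified_if_table[of "u $ 2" H06 0 0 "u $ 1"])
        (simp_all add: assms vec_eq_iff forall_3 3 s2 f2 algebra_simps
          flip: s_def f_def u_def l_def)
  qed
qed

section \<open>The three positions of the common kernel vector\<close>

lemma classified_if_e3_in_kernel:
  assumes "n e1 e3 = 0" "n e2 e3 = 0"
  shows "classified n"
proof -
  define p q r u where "p = n e1 e1" and "q = n e1 e2" and "r = n e2 e2" and "u = n e3 e3"
  note c1 = curvature_e1[unfolded assms, folded p_def q_def r_def u_def, simplified]
  note c2 = curvature_e2[unfolded assms, folded p_def q_def r_def u_def, simplified]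
  note c3 = curvature_e3[unfolded assms, folded p_def q_def r_def u_def, simplified]
  have eqs: "p $ 3 * (u $ 3 + 2) = 0" "q $ 3 * (u $ 3 + 2) = - (p $ 3)"
    "r $ 3 * (u $ 3 + 2) = - 2 * q $ 3"
    using c1(2) c2(2,3) by (simp_all add: algebra_simps)
  \<comment> \<open>If \<open>p $ 3\<close> were nonzero, \<open>eqs(1)\<close> would give
    \<open>u $ 3 = -2\<close>, and then \<open>eqs(2)\<close> would give \<open>p $ 3 = 0\<close>.
    The same argument one equation later handles \<open>q $ 3\<close>.\<close>
  have p3: "p $ 3 = 0"
    using eqs(1,2) by auto
  have q3: "q $ 3 = 0"
    using eqs(2,3) p3 by auto
  have p: "p = 0"
    using c1(2) p3 by (auto simp: vec_eq_iff forall_3 algebra_simps)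
  have q: "q = 0"
    using c2(2) p q3 by (auto simp: vec_eq_iff forall_3 algebra_simps)
  show ?thesis
  proof (cases "r $ 3 = 0")
    case True
    then have "r = 0"
      using c2(3) q by (auto simp: vec_eq_iff forall_3 algebra_simps)
    with p q show ?thesis
      using classified_if_all_zero assms by (simp add: p_def q_def r_def)
  next
    case False
    have u3: "u $ 3 = -2"
      using eqs(3) q3 False by auto
    have u2: "u $ 2 = 0"
      using c3(3) q False by (auto simp: vec_eq_iff forall_3)
    have r: "r $ 2 = 0" "r $ 1 = - (r $ 3) * u $ 1"
      using c2(3) q u2 by (auto simp: algebra_simps)
    \<comment> \<open>Scaling multiplies \<open>r $ 3\<close> by \<open>a\<^sup>2\<close>, so only
      its sign survives, as the parameter of \<open>H01\<close>.\<close>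
    define a where "a = 1 / sqrt \<bar>r $ 3\<bar>"
    have a: "a \<noteq> 0" "a\<^sup>2 * r $ 3 = sgn (r $ 3)"
      using False by (simp_all add: a_def power_divide sgn_if)
    have "a\<^sup>2 * r $ 1 = - sgn (r $ 3) * u $ 1"
      using a(2) r(2) by simp
    then show ?thesis
      using a p q False
      by (intro classified_if_table[of a "H01 (sgn (r $ 3))" 0 "- (u $ 1)" 0])
        (simp_all add: assms vec_eq_iff forall_3 u3 u2 r(1) sgn_if
          flip: p_def q_def r_def u_def)
  qed
qed

text \<open>If \<open>n e2 e3 = 0\<close>, then \<open>e3\<close> lies in the common kernel as well.
  Otherwise \<open>n e1 e1\<close> vanishes: two curvature equations annihilate it with factors
  differing by 1.\<close>

lemma classified_if_e2_in_kernel: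
  assumes q: "n e1 e2 = 0" and r: "n e2 e2 = 0"
  shows "classified n"
proof (cases "n e2 e3 = 0")
  case True
  then have "n e1 e3 = 0"
    using curvature_expand(3)[of e3] by (simp add: assms)
  with True show ?thesis
    by (intro classified_if_e3_in_kernel)
next
  case False
  define p s f where "p = n e1 e1" and "s = n e1 e3" and "f = n e2 e3"
  have "p $ 3 *\<^sub>R f = 0"
    using curvature_expand(1)[of e1] by (simp add: torsion assms flip: p_def s_def f_def)
  then have p3: "p $ 3 = 0"
    using False by (simp add: f_def)
  then have "p $ 1 + s $ 3 = 0" "(p $ 1)\<^sup>2 + (s $ 3)\<^sup>2 = 0"
    using trace_e1 by (simp_all add: assms flip: p_def s_def f_def)
  then have "s $ 3 = 0"
    by simp
  moreover have "f $ 3 = 0"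
    using trace_e2 by (simp add: assms flip: p_def s_def f_def)
  ultimately have "f $ 1 *\<^sub>R p = 0" "(f $ 1 - 1) *\<^sub>R p = 0"
    using curvature_expand(1)[of e3] curvature_expand(2)[of e2]
    by (simp_all add: assms torsion flip: p_def s_def f_def)
  then have "p = 0"
    by auto
  then show ?thesis
    by (intro classified_if_derived_products_zero) (simp_all add: assms flip: p_def)
qed

lemma classified_if_e1_in_kernel:
  assumes p: "n e1 e1 = 0" and q: "n e1 e2 = 0"
  shows "classified n"
proof (cases "n e2 e2 = 0")
  case True
  with assms show ?thesis
    by (intro classified_if_derived_products_zero)
next
  case False
  define \<nu> r s f u where "\<nu> = n e1 e3 $ 1" and "r = n e2 e2" and "s = n e1 e3"
    and "f = n e2 e3" and "u = n e3 e3"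
  note defs = \<nu>_def r_def s_def f_def u_def
  have r0: "r \<noteq> 0"
    using False by (simp add: r_def)
  have s3: "s $ 3 = 0"
    using trace_e1 by (simp add: p q s_def)
  have "s $ 2 *\<^sub>R r = 0"
    using curvature_expand(3)[of e1] by (simp add: torsion p q s3 flip: defs)
  then have s2: "s $ 2 = 0"
    using r0 by simp
  have s1: "s $ 1 = \<nu>"
    by (simp add: defs)
  have s: "s = \<nu> *\<^sub>R e1"
    by (simp add: vec_eq_iff forall_3 s1 s2 s3)
  have r3: "r $ 3 * \<nu> = 0"
    using curvature_expand(1)[of e2] by (simp add: p q s flip: defs(2-))
  have f3_r2: "f $ 3 = - (r $ 2)"
    using trace_e2(1) by (simp add: q algebra_simps eq_neg_iff_add_eq_0 flip: defs)
  then have tr: "(r $ 2)\<^sup>2 + r $ 3 * f $ 2 = 0"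
    using trace_e2(2) by (simp add: q flip: defs)
  show ?thesis
  proof (cases "r $ 3 = 0")
    case False
    \<comment> \<open>Replacing \<open>e\<^sub>3\<close> by \<open>e\<^sub>3 + d e\<^sub>2\<close> removes the \<open>e\<^sub>2\<close>-component of \<open>e\<^sub>2e\<^sub>2\<close>.\<close>
    define d where "d = r $ 2 / r $ 3"
    obtain m where m: "flat_g32 m" "classified m \<Longrightarrow> classified n"
      "\<And>X Y. aut 1 0 0 d (m X Y) = n (aut 1 0 0 d X) (aut 1 0 0 d Y)"
      using aut_pullbackE[OF one_neq_zero] by metis
    interpret m: flat_g32 m by fact
    define r' f' u' where "r' = m e2 e2" and "f' = m e2 e3" and "u' = m e3 e3"
    have m0: "m e1 e1 = 0" "m e1 e2 = 0" "m e1 e3 = 0"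
      using m(3)[of e1 e1] m(3)[of e1 e2] m(3)[of e1 e3] r3 False
      by (simp_all add: aut_axis n_add n_scale p q s aut_eq_0_iff flip: defs(2-))
    have "aut 1 0 0 d r' = r"
      using m(3)[of e2 e2] by (simp add: aut_axis r'_def r_def)
    then have r': "r' $ 3 \<noteq> 0" "r' $ 2 = 0"
      using False by (auto simp: vec_eq_iff forall_3 d_def)
    then have f': "f' $ 3 = 0" "f' $ 2 = 0"
      using m.trace_e2 by (simp_all add: m0 flip: r'_def f'_def)
    have "r' $ 3 * (u' $ 3 + 2) = 0" and u2: "u' $ 2 = 0"
      using m.curvature_e2(3) m0 f' r'
      by (simp_all add: algebra_simps flip: r'_def f'_def u'_def)
    then have u3: "u' $ 3 = -2"
      using r' by simp
    have "f' $ 1 = 0"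
      using m.curvature_e3(3) m0 f' r' u2 u3
      by (simp_all add: algebra_simps flip: r'_def f'_def u'_def)
    with f' have "f' = 0"
      by (simp add: vec_eq_iff forall_3)
    then show ?thesis
      using m.classified_if_e3_in_kernel m0 m(2) by (simp add: f'_def)
  next
    case True
    then have r2: "r $ 2 = 0" and f3: "f $ 3 = 0"
      using tr f3_r2 by auto
    have r1: "r $ 1 \<noteq> 0"
      using r0 True r2 by (simp add: vec_eq_iff forall_3)
    have "r $ 1 * (f $ 2 - \<nu> - 1) = 0"
      using curvature_e2(3) True r2 f3 s1 s2 s3 by (simp add: p q algebra_simps flip: defs)
    then have f2: "f $ 2 = \<nu> + 1"
      using r1 by simp
    have \<nu>: "\<nu> * (u $ 3 - \<nu>) = 0"
      using curvature_e3(2) s1 s2 s3 by (simp add: p q algebra_simps flip: defs)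
    have u: "f $ 2 * (u $ 3 - f $ 2) = 0"
      "u $ 2 * r $ 1 + u $ 3 * f $ 1 = \<nu> * f $ 1 + f $ 2 * (f $ 1 - 1) + \<nu>"
      using curvature_e3(3) s2 s3 r2 f3 s1 by (simp_all add: p q algebra_simps flip: defs)
    \<comment> \<open>Both \<open>\<nu>\<close> and \<open>f $ 2 = \<nu> + 1\<close> lie in {0,
      \<open>u $ 3\<close>}, which leaves two solutions.\<close>
    have \<nu>': "\<nu> = 0 \<and> u $ 3 = 1 \<or> \<nu> = -1 \<and> u $ 3 = -1"
      using \<nu> u(1) f2 by auto
    \<comment> \<open>\<open>a\<close> normalises \<open>n e2 e2\<close> to the new
      \<open>e1\<close>, \<open>d\<close> removes the \<open>e1\<close>-component of
      \<open>n e2 e3\<close>, and \<open>c\<close> adjusts that of \<open>n e3 e3\<close>. The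
      equation for \<open>c\<close> is the same for \<open>H21\<close> and
      \<open>H22\<close>.\<close>
    define a d c where "a = 1 / r $ 1" and "d = - f $ 1 / r $ 1"
      and "c = (u $ 1 + d * (2 * f $ 1 - 1) + d\<^sup>2 * r $ 1) / 2"
    have a: "a \<noteq> 0" "a\<^sup>2 * r $ 1 = a" "d * r $ 1 = - f $ 1"
      using r1 by (simp_all add: a_def d_def power2_eq_square)
    have c: "u $ 1 = 2 * c - d * (2 * f $ 1 - 1) - d\<^sup>2 * r $ 1"
      by (simp add: c_def field_simps)
    have "u $ 2 * r $ 1 = -1"
      using u(2) \<nu>' f2 by auto
    then have u2: "u $ 2 = - a"
      using r1 by (simp add: a_def field_simps)
    from \<nu>' show ?thesis
    proof
      assume "\<nu> = 0 \<and> u $ 3 = 1"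
      with a show ?thesis
        by (intro classified_if_table[of a H21 0 c d])
          (simp_all add: p q s vec_eq_iff forall_3 True r2 f2 f3 c u2 algebra_simps
            flip: defs(2-))
    next
      assume "\<nu> = -1 \<and> u $ 3 = -1"
      with a show ?thesis
        by (intro classified_if_table[of a H22 0 c d])
          (simp_all add: p q s vec_eq_iff forall_3 True r2 f2 f3 c u2 algebra_simps
            flip: defs(2-))
    qed
  qed
qed

lemma classified: "classified n"
proof -
  obtain v where v: "v \<noteq> 0" "n e1 v = 0" "n e2 v = 0"
    using kernelE .
  consider "v $ 3 \<noteq> 0" | "v $ 3 = 0" "v $ 2 \<noteq> 0" | "v $ 3 = 0" "v $ 2 = 0" "v $ 1 \<noteq> 0"
    using v(1) by (auto simp: vec_eq_iff forall_3)
  then show ?thesis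
  proof cases
    case 1
    define c d where "c = v $ 1 / v $ 3" and "d = v $ 2 / v $ 3"
    obtain m where m: "flat_g32 m" "classified m \<Longrightarrow> classified n"
      "\<And>X Y. aut 1 0 c d (m X Y) = n (aut 1 0 c d X) (aut 1 0 c d Y)"
      using aut_pullbackE[OF one_neq_zero] by metis
    have *: "aut 1 0 c d e3 = (1 / v $ 3) *\<^sub>R v"
      using 1 by (simp add: vec_eq_iff forall_3 c_def d_def)
    have "aut 1 0 c d (m e1 e3) = 0" "aut 1 0 c d (m e2 e3) = 0"
      unfolding m(3) * by (simp_all add: aut_axis n_scale v)
    then show ?thesis
      using flat_g32.classified_if_e3_in_kernel[OF m(1)] m(2) by (simp add: aut_eq_0_iff)
  next
    case 2
    let ?\<Phi> = "aut (v $ 2) (v $ 1) 0 0"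
    obtain m where m: "flat_g32 m" "classified m \<Longrightarrow> classified n"
      "\<And>X Y. ?\<Phi> (m X Y) = n (?\<Phi> X) (?\<Phi> Y)"
      using aut_pullbackE[OF 2(2)] by metis
    have *: "?\<Phi> e2 = v" "?\<Phi> e1 = v $ 2 *\<^sub>R e1"
      using 2 by (simp_all add: vec_eq_iff forall_3)
    \<comment> \<open>Without an \<open>e3\<close>-component, \<open>n v\<close> is a combination of
      \<open>n e1\<close> and \<open>n e2\<close>, which both annihilate \<open>v\<close>.\<close>
    have "n v v = 0"
      using 2 n_expand(1)[of v v] by (simp add: v)
    then have "?\<Phi> (m e1 e2) = 0" "?\<Phi> (m e2 e2) = 0"
      unfolding m(3) * by (simp_all add: n_scale v)
    then show ?thesis
      using flat_g32.classified_if_e2_in_kernel[OF m(1)] m(2) 2(2) by (simp add: aut_eq_0_iff)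
  next
    case 3
    then have "n e1 e1 = 0" "n e2 e1 = 0"
      using v n_expand(2)[of e1 v] n_expand(2)[of e2 v] by simp_all
    then show ?thesis
      using classified_if_e1_in_kernel torsion(1) by simp
  qed
qed

end

theorem proposition5:
  fixes nabla :: "real ^ 3 \<Rightarrow> real ^ 3 \<Rightarrow> real ^ 3"
  assumes "flat_lie_algebra g32 nabla"
  shows "\<exists>!h. admissible h \<and> isomorphic_connections g32 nabla (list_connection h)"
proof -
  have "classified nabla"
    using assms by (intro flat_g32.classified) (simp add: flat_g32_def)
  then show ?thesis
    unfolding classified_def
    by (metis isomorphic_connections_sym isomorphic_connections_trans list_connection_unique)
qed

end
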